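(* For every $N\ge1$, $$\mathrm{Var}\bigl(\widehat\theta^{(N)}\bigr)\le\frac{\alpha^{2}}{\|\mathbf T\|^{4}}\Bigl(\sum_{j=1}^{N}t_j\Bigr)\Bigl(\sum_{r=1}^{m}\sum_{i=1}^{N}t_i^{2H_r+1}\Bigr)$$ and consequently $$\mathrm{Var}\bigl(\widehat\theta^{(N)}\bigr)\le\frac92\,\alpha^{2}\sum_{r=1}^{m}(Nh)^{2H_r-2}=\frac92\,\alpha^{2}\sum_{r=1}^{m}t_N^{2H_r-2}.$$ If moreover $Nh\ge1$, then $\mathrm{Var}(\widehat\theta^{(N)})\le\frac92m\alpha^{2}(Nh)^{2H_{\max}-2}$, where $H_{\max}=\max_{1\le r\le m}H_r$. In particular $\widehat\theta^{(N)}$ is unbiased with $\mathrm{Var}(\widehat\theta^{(N)})\to0$; that is, $\widehat\theta^{(N)}\to\theta$ in mean square as $N\to\infty$ (with $h$ fixed).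
   Context: Fix a mesh $h>0$, an integer $m\ge1$ and known Hurst parameters $H_1,\dots,H_m\in(1/2,1)$. Let $B^{H_1},\dots,B^{H_m}$ be independent fractional Brownian motions, i.e. independent centred continuous Gaussian processes with $B^{H_r}(0)=0$ and $\mathbb E[B^{H_r}(t)B^{H_r}(s)]=\frac12(t^{2H_r}+s^{2H_r}-|t-s|^{2H_r})$ for $s,t\ge0$. For $\theta\in\mathbb R$ and $\alpha>0$ set $Z(t)=\theta t+\alpha\sum_{r=1}^m B^{H_r}(t)$, $t_k=kh$, $\mathbf T=(t_1,\dots,t_N)^\top$, $\mathbf Z=(Z(t_1),\dots,Z(t_N))^\top$. Let $\Gamma_H=\sum_{r=1}^m\Gamma_{H_r}$ be the $N\times N$ positive definite matrix with $(\Gamma_{H_r})_{ij}=\frac12(t_i^{2H_r}+t_j^{2H_r}-|t_i-t_j|^{2H_r})$. Put $\widehat\theta^{(N)}=\mathbf T^\top\Gamma_H^{-1}\mathbf Z/(\mathbf T^\top\Gamma_H^{-1}\mathbf T)$. $\|\cdot\|$ is the Euclidean norm. *)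

theory Defs
  imports
    "HOL-Probability.Probability"
    "Jordan_Normal_Form.Gauss_Jordan_Elimination"
begin

section \<open>Gaussian processes and fractional Brownian motion\<close>

(* Constants count as (degenerate) Gaussian variables: a fractional Brownian motion
   vanishes at time 0, and linear combinations may cancel. *)
definition gaussian_rv :: "'a measure \<Rightarrow> ('a \<Rightarrow> real) \<Rightarrow> bool" where
  "gaussian_rv M X \<longleftrightarrow>
     (\<exists>\<mu> \<sigma>. \<sigma> > 0 \<and> distributed M lborel X (normal_density \<mu> \<sigma>)) \<or>
     (X \<in> borel_measurable M \<and> (\<exists>\<mu>. AE \<omega> in M. X \<omega> = \<mu>))"

definition gaussian_process :: "'a measure \<Rightarrow> 't set \<Rightarrow> ('t \<Rightarrow> 'a \<Rightarrow> real) \<Rightarrow> bool" where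
  "gaussian_process M T X \<longleftrightarrow>
     (\<forall>S c. finite S \<longrightarrow> S \<subseteq> T \<longrightarrow> gaussian_rv M (\<lambda>\<omega>. \<Sum>t\<in>S. c t * X t \<omega>))"

(* powr is used with exponent 2 * H > 0 only, where 0 powr (2 * H) = 0 is the right value. *)
definition fbm_cov :: "real \<Rightarrow> real \<Rightarrow> real \<Rightarrow> real" where
  "fbm_cov H t s = 1 / 2 * (t powr (2 * H) + s powr (2 * H) - \<bar>t - s\<bar> powr (2 * H))"

(* Only the values B t for t \<ge> 0 matter; path properties are required almost surely. *)
definition fractional_brownian_motion ::
    "'a measure \<Rightarrow> real \<Rightarrow> (real \<Rightarrow> 'a \<Rightarrow> real) \<Rightarrow> bool" where
  "fractional_brownian_motion M H B \<longleftrightarrow>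
     gaussian_process M {0..} B \<and>
     (\<forall>t\<ge>0. integral\<^sup>L M (B t) = 0) \<and>
     (AE \<omega> in M. continuous_on {0..} (\<lambda>t. B t \<omega>)) \<and>
     (AE \<omega> in M. B 0 \<omega> = 0) \<and>
     (\<forall>t\<ge>0. \<forall>s\<ge>0. integral\<^sup>L M (\<lambda>\<omega>. B t \<omega> * B s \<omega>) = fbm_cov H t s)"

(* Mutual independence of the processes as random elements of the product space of paths. *)
definition independent_processes ::
    "'a measure \<Rightarrow> 'i set \<Rightarrow> 't set \<Rightarrow> ('i \<Rightarrow> 't \<Rightarrow> 'a \<Rightarrow> real) \<Rightarrow> bool" where
  "independent_processes M I T X \<longleftrightarrow>
     prob_space.indep_vars M (\<lambda>_. PiM T (\<lambda>_. borel)) (\<lambda>i \<omega>. \<lambda>t\<in>T. X i t \<omega>) I"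


section \<open>The observed process and the estimator\<close>

definition obs_process ::
    "real \<Rightarrow> real \<Rightarrow> nat \<Rightarrow> (nat \<Rightarrow> real \<Rightarrow> 'a \<Rightarrow> real) \<Rightarrow> real \<Rightarrow> 'a \<Rightarrow> real" where
  "obs_process \<theta> \<alpha> m B t \<omega> = \<theta> * t + \<alpha> * (\<Sum>r=1..m. B r t \<omega>)"

definition grid :: "real \<Rightarrow> nat \<Rightarrow> real" where
  "grid h k = real k * h"

(* Vectors and matrices are indexed from 0, so position i belongs to time grid h (i + 1). *)
definition time_vec :: "real \<Rightarrow> nat \<Rightarrow> real vec" where
  "time_vec h N = Matrix.vec N (\<lambda>i. grid h (i + 1))"

definition obs_vec :: "(real \<Rightarrow> 'a \<Rightarrow> real) \<Rightarrow> real \<Rightarrow> nat \<Rightarrow> 'a \<Rightarrow> real vec" where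
  "obs_vec Z h N \<omega> = Matrix.vec N (\<lambda>i. Z (grid h (i + 1)) \<omega>)"

definition fbm_cov_mat :: "real \<Rightarrow> real \<Rightarrow> nat \<Rightarrow> real mat" where
  "fbm_cov_mat H h N = Matrix.mat N N (\<lambda>(i, j). fbm_cov H (grid h (i + 1)) (grid h (j + 1)))"

(* The matrix sum is written entrywise, as real mat carries no additive monoid structure. *)
definition mixed_cov_mat :: "(nat \<Rightarrow> real) \<Rightarrow> nat \<Rightarrow> real \<Rightarrow> nat \<Rightarrow> real mat" where
  "mixed_cov_mat H m h N = Matrix.mat N N (\<lambda>(i, j). \<Sum>r=1..m. fbm_cov_mat (H r) h N $$ (i, j))"

definition euclid_norm :: "real vec \<Rightarrow> real" where
  "euclid_norm v = sqrt (scalar_prod v v)"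

definition drift_estimator ::
    "(nat \<Rightarrow> real) \<Rightarrow> nat \<Rightarrow> real \<Rightarrow> (real \<Rightarrow> 'a \<Rightarrow> real) \<Rightarrow> nat \<Rightarrow> 'a \<Rightarrow> real" where
  "drift_estimator H m h Z N \<omega> =
     (let \<Gamma>inv = the (mat_inverse (mixed_cov_mat H m h N)); T = time_vec h N
      in scalar_prod T (\<Gamma>inv *\<^sub>v obs_vec Z h N \<omega>) / scalar_prod T (\<Gamma>inv *\<^sub>v T))"


section \<open>Unbiasedness and mean-square convergence\<close>

definition unbiased :: "'a measure \<Rightarrow> ('a \<Rightarrow> real) \<Rightarrow> real \<Rightarrow> bool" where
  "unbiased M X \<theta> \<longleftrightarrow> integrable M X \<and> integral\<^sup>L M X = \<theta>"

(* Square integrability is demanded explicitly, because the Bochner integral of a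
   non-integrable function is 0. *)
definition tendsto_mean_square :: "'a measure \<Rightarrow> (nat \<Rightarrow> 'a \<Rightarrow> real) \<Rightarrow> real \<Rightarrow> bool" where
  "tendsto_mean_square M X \<theta> \<longleftrightarrow>
     (\<forall>\<^sub>F n in sequentially.
        X n \<in> borel_measurable M \<and> integrable M (\<lambda>\<omega>. (X n \<omega> - \<theta>)\<^sup>2)) \<and>
     (\<lambda>n. integral\<^sup>L M (\<lambda>\<omega>. (X n \<omega> - \<theta>)\<^sup>2)) \<longlonglongrightarrow> 0"

end

(* The estimator is generalised least squares: with w = inverse(\<Gamma>) T and q = T \<bullet> w > 0 it equals
   \<theta> + (\<alpha> / q) w \<bullet> (noise), so its variance is \<alpha>\<^sup>2 / q, and the Cauchy-Schwarz inequality
   (T \<bullet> T)\<^sup>2 \<le> (T \<bullet> \<Gamma> T) q for the form of \<Gamma> bounds it by the variance of ordinary least squares.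
   Dropping the terms -|t - s|^(2H) from the covariance factorises T \<bullet> \<Gamma> T.

   All this needs \<Gamma> to be nonsingular. If a nontrivial linear combination of fBm values on the grid
   vanished in L2, then, the increments being stationary, the autocovariance of the increments would
   satisfy a linear recurrence with constant coefficients on all of the integers. A sequence of this
   kind that tends to 0 at both ends is 0, as one sees by splitting off one root of the
   characteristic polynomial at a time; but the autocovariance tends to 0 and is positive at lag 0. *)
theory Submission
  imports Defs "Jordan_Normal_Form.Determinant"
    "HOL-Computational_Algebra.Fundamental_Theorem_Algebra" "HOL-Real_Asymp.Real_Asymp"
begin

section \<open>Two-sided sequences: a decaying solution of a constant-coefficient recurrence is
  zero\<close>

section \<open>Linear recurrences on the integers\<close>

lemma filterlim_cofinite_inj:
  fixes f :: "'a \<Rightarrow> 'b"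
  assumes "inj f"
  shows "filterlim f cofinite cofinite"
proof (unfold filterlim_iff eventually_cofinite, intro allI impI)
  fix P :: "'b \<Rightarrow> bool"
  assume "finite {y. \<not> P y}"
  from finite_vimageI[OF this assms] show "finite {x. \<not> P (f x)}" by (simp add: vimage_def)
qed

text \<open>On the integers the filter \<open>cofinite\<close> expresses decay at both ends. If |z|
  >= 1 the norms do not decrease to the right, otherwise they do not decrease to the left. Following
  that direction \<open>s\<close>, the value at k stays dominated by terms tending to 0.\<close>

lemma geometric_int_eq_0:
  fixes g :: "int \<Rightarrow> 'a::real_normed_field"
  assumes lim: "(g \<longlongrightarrow> 0) cofinite" and step: "\<And>k. g (k + 1) = z * g k"
  shows "g k = 0"
proof -
  define s :: int where "s = (if norm z \<ge> 1 then 1 else -1)"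
  have le: "norm (g k) \<le> norm (g (k + s))" for k
  proof (cases "norm z \<ge> 1")
    case True
    then show ?thesis
      using mult_right_mono[of 1 "norm z" "norm (g k)"] by (simp add: s_def step norm_mult)
  next
    case False
    then have "norm z * norm (g (k - 1)) \<le> 1 * norm (g (k - 1))"
      by (intro mult_right_mono) auto
    then show ?thesis
      using False step[of "k - 1"] by (simp add: s_def norm_mult)
  qed
  have le_n: "norm (g k) \<le> norm (g (k + int n * s))" for n
  proof (induction n)
    case (Suc n)
    then show ?case using le[of "k + int n * s"] by (simp add: algebra_simps)
  qed simp
  have "inj (\<lambda>n::nat. k + int n * s)" by (auto simp: inj_def s_def)
  then have "(\<lambda>n. g (k + int n * s)) \<longlonglongrightarrow> 0"
    unfolding cofinite_eq_sequentially[symmetric]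
    by (rule filterlim_compose[OF lim filterlim_cofinite_inj])
  from tendsto_norm[OF this] have "norm (g k) \<le> 0"
    using le_n by (intro LIMSEQ_le_const) auto
  then show ?thesis by simp
qed

text \<open>This is p(E) g, where E is the shift (E g)(k) = g(k + 1); its vanishing for all k is the
  recurrence with characteristic polynomial p.\<close>

definition shift_apply :: "'a::comm_ring_1 poly \<Rightarrow> (int \<Rightarrow> 'a) \<Rightarrow> int \<Rightarrow> 'a" where
  "shift_apply p g k = (\<Sum>i\<le>degree p. coeff p i * g (k + int i))"

lemma shift_apply_extend:
  assumes "degree p \<le> n"
  shows "shift_apply p g k = (\<Sum>i\<le>n. coeff p i * g (k + int i))"
  unfolding shift_apply_def using assms
  by (intro sum.mono_neutral_left) (auto simp: coeff_eq_0)

text \<open>Products of polynomials act as compositions of shift operators, here (E - z) after q(E).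
  In the proof both sums are extended to the common bound \<open>Suc (degree q)\<close>, and
  multiplication by the variable becomes \<open>pCons 0 q\<close>.\<close>

lemma shift_apply_linear_factor:
  fixes q :: "'a::idom poly"
  shows "shift_apply ([:- z, 1:] * q) g k = shift_apply q g (k + 1) - z * shift_apply q g k"
proof -
  have deg: "degree ([:- z, 1:] * q) \<le> Suc (degree q)"
    using degree_mult_le[of "[:- z, 1:]" q] by simp
  have "shift_apply ([:- z, 1:] * q) g k
      = (\<Sum>i\<le>Suc (degree q). coeff (pCons 0 q) i * g (k + int i))
        - z * (\<Sum>i\<le>Suc (degree q). coeff q i * g (k + int i))"
    unfolding shift_apply_extend[OF deg]
    by (simp add: sum_distrib_left algebra_simps flip: sum_subtractf del: sum.atMost_Suc)
  also have "(\<Sum>i\<le>Suc (degree q). coeff (pCons 0 q) i * g (k + int i)) = shift_apply q g (k + 1)"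
    by (subst sum.atMost_Suc_shift) (simp add: shift_apply_def algebra_simps)
  also have "(\<Sum>i\<le>Suc (degree q). coeff q i * g (k + int i)) = shift_apply q g k"
    by (rule shift_apply_extend[symmetric]) simp
  finally show ?thesis .
qed

lemma tendsto_shift_apply:
  fixes g :: "int \<Rightarrow> 'a::real_normed_field"
  assumes "(g \<longlongrightarrow> 0) cofinite"
  shows "(shift_apply p g \<longlongrightarrow> 0) cofinite"
proof -
  have "((\<lambda>k. g (k + int i)) \<longlongrightarrow> 0) cofinite" for i
    by (rule filterlim_compose[OF assms filterlim_cofinite_inj]) (simp add: inj_def)
  then show ?thesis
    unfolding shift_apply_def[abs_def] by (auto intro!: tendsto_null_sum tendsto_mult_right_zero)
qed

text \<open>Write p = (X - z) q for a complex root z. Then q(E) g is geometric with ratio z and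
  still decays, hence is zero, and g satisfies the recurrence of the smaller degree. A nonzero
  constant polynomial ends the descent.\<close>

lemma linear_recurrence_int_eq_0:
  fixes g :: "int \<Rightarrow> complex"
  assumes "(g \<longlongrightarrow> 0) cofinite" and "p \<noteq> 0" and "\<And>k. shift_apply p g k = 0"
  shows "g k = 0"
  using assms(2,3)
proof (induction "degree p" arbitrary: p)
  case 0
  then obtain a where "p = [:a:]" by (metis degree_eq_zeroE)
  with 0 show ?case by (simp add: shift_apply_def)
next
  case (Suc n)
  then have "\<not> constant (poly p)" by (simp add: constant_degree)
  then obtain z where "poly p z = 0" using fundamental_theorem_of_algebra by blast
  then obtain q where p: "p = [:- z, 1:] * q" by (auto simp: poly_eq_0_iff_dvd elim: dvdE)
  with Suc.prems have "q \<noteq> 0" by auto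
  then have "degree q = n" using Suc.hyps(2) by (simp add: p degree_mult_eq del: mult_pCons_left)
  have "shift_apply q g k = 0" for k
  proof (rule geometric_int_eq_0[OF tendsto_shift_apply[OF assms(1)]])
    show "shift_apply q g (k + 1) = z * shift_apply q g k" for k
      using Suc.prems(2)[of k] unfolding p shift_apply_linear_factor by simp
  qed
  then show ?case using Suc.hyps(1) \<open>q \<noteq> 0\<close> \<open>degree q = n\<close> by blast
qed

text \<open>The second difference is of order n^(a-2), and a < 2. With a = 2H this is the decay of
  the autocovariance of the fBm increments.\<close>

lemma powr_second_difference_tendsto:
  fixes a :: real
  assumes "1 < a" "a < 2"
  shows "(\<lambda>n. (real n + 1) powr a - 2 * real n powr a + (real n - 1) powr a) \<longlonglongrightarrow> 0"
  using assms by real_asymp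

section \<open>Integrability, means and covariances of linear combinations of fBm values\<close>

section \<open>Second moments of fractional Brownian motion\<close>

lemma (in prob_space) expectation_lincomb_mult:
  fixes X :: "'i \<Rightarrow> 'a \<Rightarrow> real" and Y :: "'j \<Rightarrow> 'a \<Rightarrow> real"
  assumes "\<And>i j. i \<in> I \<Longrightarrow> j \<in> J \<Longrightarrow> integrable M (\<lambda>\<omega>. X i \<omega> * Y j \<omega>)"
  shows "integrable M (\<lambda>\<omega>. (\<Sum>i\<in>I. a i * X i \<omega>) * (\<Sum>j\<in>J. b j * Y j \<omega>))"
    and "expectation (\<lambda>\<omega>. (\<Sum>i\<in>I. a i * X i \<omega>) * (\<Sum>j\<in>J. b j * Y j \<omega>))
      = (\<Sum>i\<in>I. \<Sum>j\<in>J. a i * b j * expectation (\<lambda>\<omega>. X i \<omega> * Y j \<omega>))"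
proof -
  have *: "(\<Sum>i\<in>I. a i * X i \<omega>) * (\<Sum>j\<in>J. b j * Y j \<omega>)
      = (\<Sum>i\<in>I. \<Sum>j\<in>J. a i * b j * (X i \<omega> * Y j \<omega>))" for \<omega>
    by (simp add: sum_product mult_ac)
  show "integrable M (\<lambda>\<omega>. (\<Sum>i\<in>I. a i * X i \<omega>) * (\<Sum>j\<in>J. b j * Y j \<omega>))"
    unfolding * by (intro Bochner_Integration.integrable_sum integrable_mult_right assms)
  show "expectation (\<lambda>\<omega>. (\<Sum>i\<in>I. a i * X i \<omega>) * (\<Sum>j\<in>J. b j * Y j \<omega>))
      = (\<Sum>i\<in>I. \<Sum>j\<in>J. a i * b j * expectation (\<lambda>\<omega>. X i \<omega> * Y j \<omega>))"
    unfolding *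
    by (subst Bochner_Integration.integral_sum,
        (intro Bochner_Integration.integrable_sum integrable_mult_right assms; assumption),
        intro sum.cong refl, subst Bochner_Integration.integral_sum,
        (intro integrable_mult_right assms; assumption),
        intro sum.cong refl integral_mult_right_zero)
qed

lemma integrable_mult_of_squares:
  fixes f g :: "'a \<Rightarrow> real"
  assumes "f \<in> borel_measurable M" "g \<in> borel_measurable M"
    and "integrable M (\<lambda>x. f x ^ 2)" "integrable M (\<lambda>x. g x ^ 2)"
  shows "integrable M (\<lambda>x. f x * g x)"
proof (rule Bochner_Integration.integrable_bound)
  show "integrable M (\<lambda>x. f x ^ 2 + g x ^ 2)" using assms by simp
  have "\<bar>f x * g x\<bar> \<le> f x ^ 2 + g x ^ 2" for x
  proof -
    have "2 * (\<bar>f x\<bar> * \<bar>g x\<bar>) \<le> f x ^ 2 + g x ^ 2" "0 \<le> \<bar>f x\<bar> * \<bar>g x\<bar>"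
      using sum_squares_bound[of "\<bar>f x\<bar>" "\<bar>g x\<bar>"] by simp_all
    then show ?thesis unfolding abs_mult by linarith
  qed
  then show "AE x in M. norm (f x * g x) \<le> norm (f x ^ 2 + g x ^ 2)" by simp
qed (use assms in measurable)

lemma fbm_cov_same: "H > 0 \<Longrightarrow> t \<ge> 0 \<Longrightarrow> fbm_cov H t t = t powr (2 * H)"
  by (simp add: fbm_cov_def)

lemma fbm_covariance:
  assumes "fractional_brownian_motion M H B" "t \<ge> 0" "s \<ge> 0"
  shows "integral\<^sup>L M (\<lambda>\<omega>. B t \<omega> * B s \<omega>) = fbm_cov H t s"
  using assms unfolding fractional_brownian_motion_def by blast

lemma fbm_mean:
  assumes "fractional_brownian_motion M H B" "t \<ge> 0"
  shows "integral\<^sup>L M (B t) = 0"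
  using assms unfolding fractional_brownian_motion_def by blast

text \<open>Measurability is contained in \<open>gaussian_process\<close>: the one-term combination
  with coefficient 1 extracts it, in the nondegenerate as well as in the constant case.\<close>

lemma fbm_measurable:
  assumes "fractional_brownian_motion M H B" "t \<ge> 0"
  shows "B t \<in> borel_measurable M"
proof -
  have "gaussian_process M {0..} B"
    using assms(1) unfolding fractional_brownian_motion_def by blast
  from this[unfolded gaussian_process_def, rule_format, of "{t}" "\<lambda>_. 1"] assms(2)
  have "gaussian_rv M (\<lambda>\<omega>. \<Sum>s\<in>{t}. 1 * B s \<omega>)"
    by (simp del: sum.insert)
  then show ?thesis
    unfolding gaussian_rv_def
  proof (elim disjE exE conjE)
    fix \<mu> \<sigma> assume "distributed M lborel (\<lambda>\<omega>. \<Sum>s\<in>{t}. 1 * B s \<omega>) (normal_density \<mu> \<sigma>)"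
    from distributed_measurable[OF this] show ?thesis by simp
  qed simp
qed

text \<open>For t > 0 the covariance formula gives the integral the nonzero value t^(2H), whereas a
  non-integrable function would have Bochner integral 0. That argument says nothing at t = 0, where
  the path vanishes almost surely instead.\<close>

lemma fbm_square_integrable:
  assumes B: "fractional_brownian_motion M H B" and "H > 0" "t \<ge> 0"
  shows "integrable M (\<lambda>\<omega>. B t \<omega> ^ 2)"
proof (cases "t = 0")
  case True
  have [measurable]: "B 0 \<in> borel_measurable M" using fbm_measurable[OF B] by simp
  have "integrable M (\<lambda>\<omega>. B 0 \<omega> ^ 2) \<longleftrightarrow> integrable M (\<lambda>\<omega>. 0 :: real)"
    using B by (intro integrable_cong_AE) (auto simp: fractional_brownian_motion_def)
  then show ?thesis using True by simp
next
  case False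
  then have "integral\<^sup>L M (\<lambda>\<omega>. B t \<omega> ^ 2) = t powr (2 * H)"
    unfolding power2_eq_square using assms by (simp add: fbm_covariance[OF B] fbm_cov_same)
  then have "integral\<^sup>L M (\<lambda>\<omega>. B t \<omega> ^ 2) \<noteq> 0" using False by simp
  then show ?thesis using not_integrable_integral_eq by blast
qed

lemma fbm_mult_integrable:
  assumes "fractional_brownian_motion M H B" "H > 0" "t \<ge> 0"
    and "fractional_brownian_motion M H' B'" "H' > 0" "s \<ge> 0"
  shows "integrable M (\<lambda>\<omega>. B t \<omega> * B' s \<omega>)"
  by (rule integrable_mult_of_squares[OF fbm_measurable[OF assms(1,3)] fbm_measurable[OF assms(4,6)]
        fbm_square_integrable[OF assms(1-3)] fbm_square_integrable[OF assms(4-6)]])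

lemma (in prob_space) fbm_integrable:
  assumes "fractional_brownian_motion M H B" "H > 0" "t \<ge> 0"
  shows "integrable M (B t)"
  using square_integrable_imp_integrable[OF fbm_measurable[OF assms(1,3)] fbm_square_integrable[OF assms]] .

lemma grid_nonneg: "h \<ge> 0 \<Longrightarrow> grid h k \<ge> 0"
  by (simp add: grid_def)

lemma (in prob_space) fbm_lincomb_mult:
  fixes t s :: "nat \<Rightarrow> real"
  assumes B: "fractional_brownian_motion M H B" and H: "H > 0"
    and "\<And>i. i \<in> I \<Longrightarrow> t i \<ge> 0" "\<And>j. j \<in> J \<Longrightarrow> s j \<ge> 0"
  shows "integrable M (\<lambda>\<omega>. (\<Sum>i\<in>I. a i * B (t i) \<omega>) * (\<Sum>j\<in>J. b j * B (s j) \<omega>))"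
    and "expectation (\<lambda>\<omega>. (\<Sum>i\<in>I. a i * B (t i) \<omega>) * (\<Sum>j\<in>J. b j * B (s j) \<omega>))
      = (\<Sum>i\<in>I. \<Sum>j\<in>J. a i * b j * fbm_cov H (t i) (s j))"
proof -
  note int = fbm_mult_integrable[OF B H _ B H]
  show "integrable M (\<lambda>\<omega>. (\<Sum>i\<in>I. a i * B (t i) \<omega>) * (\<Sum>j\<in>J. b j * B (s j) \<omega>))"
    by (rule expectation_lincomb_mult(1)) (rule int[OF assms(3,4)])
  have "expectation (\<lambda>\<omega>. (\<Sum>i\<in>I. a i * B (t i) \<omega>) * (\<Sum>j\<in>J. b j * B (s j) \<omega>))
      = (\<Sum>i\<in>I. \<Sum>j\<in>J. a i * b j * expectation (\<lambda>\<omega>. B (t i) \<omega> * B (s j) \<omega>))"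
    by (rule expectation_lincomb_mult(2)) (rule int[OF assms(3,4)])
  also have "\<dots> = (\<Sum>i\<in>I. \<Sum>j\<in>J. a i * b j * fbm_cov H (t i) (s j))"
    by (intro sum.cong refl arg_cong2[of _ _ _ _ times] fbm_covariance[OF B assms(3,4)])
  finally show "expectation (\<lambda>\<omega>. (\<Sum>i\<in>I. a i * B (t i) \<omega>) * (\<Sum>j\<in>J. b j * B (s j) \<omega>))
      = (\<Sum>i\<in>I. \<Sum>j\<in>J. a i * b j * fbm_cov H (t i) (s j))" .
qed

section \<open>Strict positivity of the fBm covariance form, from the stationarity of the
  increments\<close>

section \<open>Positive definiteness of the covariance on a grid\<close>

text \<open>Each of the terms \<open>f i\<close> and \<open>f j\<close> leaves a free sum of the
  coefficients, which is 0; only the lag term survives.\<close>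

lemma sum_lag_eq:
  fixes e :: "nat \<Rightarrow> real" and f :: "nat \<Rightarrow> real" and g :: "nat \<Rightarrow> nat \<Rightarrow> real"
  assumes "(\<Sum>i\<le>N. e i) = 0"
  shows "(\<Sum>i\<le>N. \<Sum>j\<le>N. e i * e j * (1 / 2 * (f i + f j - g i j)))
    = - (1 / 2) * (\<Sum>i\<le>N. \<Sum>j\<le>N. e i * e j * g i j)"
proof -
  have "(\<Sum>i\<le>N. \<Sum>j\<le>N. e i * e j * f i) = (\<Sum>i\<le>N. e i * f i) * (\<Sum>j\<le>N. e j)"
    by (simp only: sum_product) (simp add: mult_ac)
  moreover have "(\<Sum>i\<le>N. \<Sum>j\<le>N. e i * e j * f j) = (\<Sum>i\<le>N. e i) * (\<Sum>j\<le>N. e j * f j)"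
    by (simp only: sum_product) (simp add: mult_ac)
  moreover have "(\<Sum>i\<le>N. \<Sum>j\<le>N. e i * e j * (1 / 2 * (f i + f j - g i j)))
    = (\<Sum>i\<le>N. \<Sum>j\<le>N. 1 / 2 * (e i * e j * f i) + 1 / 2 * (e i * e j * f j)
        - 1 / 2 * (e i * e j * g i j))"
    by (intro sum.cong refl) (simp add: field_simps)
  moreover have "\<dots> = 1 / 2 * (\<Sum>i\<le>N. \<Sum>j\<le>N. e i * e j * f i)
      + 1 / 2 * (\<Sum>i\<le>N. \<Sum>j\<le>N. e i * e j * f j) - 1 / 2 * (\<Sum>i\<le>N. \<Sum>j\<le>N. e i * e j * g i j)"
    by (simp only: sum.distrib sum_subtractf sum_distrib_left[symmetric])
  ultimately show ?thesis using assms by simp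
qed

lemma filterlim_nat_abs_cofinite: "filterlim (\<lambda>k::int. nat \<bar>k\<bar>) sequentially cofinite"
  unfolding filterlim_at_top eventually_cofinite
proof
  fix n :: nat
  have "{k::int. \<not> n \<le> nat \<bar>k\<bar>} \<subseteq> {- int n..int n}" by auto
  then show "finite {k::int. \<not> n \<le> nat \<bar>k\<bar>}" by (rule finite_subset) simp
qed

text \<open>The variance of an fBm increment over k grid steps, as an even function on all integers
  so that recurrences can run in both directions.\<close>

definition lag_powr :: "real \<Rightarrow> real \<Rightarrow> int \<Rightarrow> real" where
  "lag_powr H h k = \<bar>real_of_int k * h\<bar> powr (2 * H)"

lemma fbm_cov_grid:
  assumes "h \<ge> 0"
  shows "fbm_cov H (grid h i) (grid h j)
    = 1 / 2 * (lag_powr H h (int i) + lag_powr H h (int j) - lag_powr H h (int i - int j))"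
proof -
  have "grid h i = \<bar>real_of_int (int i) * h\<bar>" for i
    using assms by (simp add: grid_def)
  moreover have "\<bar>grid h i - grid h j\<bar> = \<bar>real_of_int (int i - int j) * h\<bar>"
    by (simp add: grid_def algebra_simps)
  ultimately show ?thesis unfolding fbm_cov_def lag_powr_def by simp
qed

text \<open>Twice the autocovariance at lag k of fractional Gaussian noise, the sequence of fBm
  increments over one grid step.\<close>

definition fgn_cov :: "real \<Rightarrow> real \<Rightarrow> int \<Rightarrow> real" where
  "fgn_cov H h k = lag_powr H h (k + 1) - 2 * lag_powr H h k + lag_powr H h (k - 1)"

lemma fgn_cov_0: "h > 0 \<Longrightarrow> fgn_cov H h 0 > 0"
  by (simp add: fgn_cov_def lag_powr_def)

lemma fgn_cov_tendsto_0:
  assumes "1 / 2 < H" "H < 1" "h > 0"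
  shows "(fgn_cov H h \<longlongrightarrow> 0) cofinite"
proof -
  define f where "f n = (real n + 1) powr (2 * H) - 2 * real n powr (2 * H) + (real n - 1) powr (2 * H)" for n
  have "f \<longlonglongrightarrow> 0" unfolding f_def using assms by (intro powr_second_difference_tendsto) auto
  then have "((\<lambda>k::int. h powr (2 * H) * f (nat \<bar>k\<bar>)) \<longlongrightarrow> 0) cofinite"
    by (intro tendsto_mult_right_zero filterlim_compose[OF _ filterlim_nat_abs_cofinite])
  moreover have "fgn_cov H h k = h powr (2 * H) * f (nat \<bar>k\<bar>)" if "k \<noteq> 0" for k
  proof -
    define x where "x = \<bar>real_of_int k\<bar>"
    have lag: "lag_powr H h i = h powr (2 * H) * \<bar>real_of_int i\<bar> powr (2 * H)" for i
      using assms by (simp add: lag_powr_def abs_mult powr_mult)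
    have fgn: "fgn_cov H h k = h powr (2 * H) * ((\<bar>real_of_int (k + 1)\<bar> powr (2 * H)
        + \<bar>real_of_int (k - 1)\<bar> powr (2 * H)) - 2 * x powr (2 * H))"
      unfolding fgn_cov_def lag x_def
      by (simp only: ring_distribs)
    \<comment> \<open>The sign of k only decides which neighbour of k lies farther from 0, and the
      sum of the two powers is symmetric in them. At k = 0 both neighbours are at distance 1, so
      that lag is left out; one exception does not affect a \<open>cofinite\<close> limit.\<close>
    have "\<bar>real_of_int (k + 1)\<bar> = x + 1 \<and> \<bar>real_of_int (k - 1)\<bar> = x - 1
        \<or> \<bar>real_of_int (k + 1)\<bar> = x - 1 \<and> \<bar>real_of_int (k - 1)\<bar> = x + 1"
    proof (cases "k > 0")
      case True
      then have "real_of_int k \<ge> 1" by simp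
      then show ?thesis unfolding x_def by simp
    next
      case False
      then have "real_of_int k \<le> -1" using that by simp
      then show ?thesis unfolding x_def by simp
    qed
    then have "\<bar>real_of_int (k + 1)\<bar> powr (2 * H) + \<bar>real_of_int (k - 1)\<bar> powr (2 * H)
        = (x + 1) powr (2 * H) + (x - 1) powr (2 * H)"
      by (elim disjE conjE) simp_all
    moreover have "real (nat \<bar>k\<bar>) = x" by (simp add: x_def)
    ultimately show ?thesis unfolding fgn f_def by (simp add: add_ac)
  qed
  then have "eventually (\<lambda>k. fgn_cov H h k = h powr (2 * H) * f (nat \<bar>k\<bar>)) cofinite"
    unfolding eventually_cofinite by - (rule finite_subset[of _ "{0}"], auto)
  ultimately show ?thesis using tendsto_cong by force
qed

text \<open>If the form were not positive, the combination would vanish almost surely together with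
  all its grid translates. Correlating these with single values of B yields a recurrence for
  \<open>fgn_cov\<close>, which would have to be zero, contrary to its value at lag 0.\<close>

lemma (in prob_space) fbm_cov_grid_pos_def:
  assumes B: "fractional_brownian_motion M H B" and H: "1 / 2 < H" "H < 1" and h: "h > 0"
    and c: "i0 < N" "c i0 \<noteq> 0"
  shows "0 < (\<Sum>i<N. \<Sum>j<N. c i * c j * fbm_cov H (grid h (i + 1)) (grid h (j + 1)))"
proof (rule ccontr)
  define f where "f = lag_powr H h"
  \<comment> \<open>B vanishes at time 0, so its free coefficient there is chosen to make the coefficients sum to 0;
    then Y s is a combination of increments and its second moment does not depend on s.\<close>
  define e where "e i = (case i of 0 \<Rightarrow> - (\<Sum>i<N. c i) | Suc i \<Rightarrow> c i)" for i
  define Y where "Y s \<omega> = (\<Sum>i\<le>N. e i * B (grid h (i + s)) \<omega>)" for s \<omega>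
  let ?Q = "\<Sum>i<N. \<Sum>j<N. c i * c j * fbm_cov H (grid h (i + 1)) (grid h (j + 1))"
  assume "\<not> 0 < ?Q"
  have H0: "H > 0" using H by simp
  have nn: "grid h k \<ge> 0" for k using h by (simp add: grid_nonneg)
  have f0: "f 0 = 0" using H0 by (simp add: f_def lag_powr_def)
  have f_minus: "f (- k) = f k" for k by (simp add: f_def lag_powr_def)
  have cov: "fbm_cov H (grid h i) (grid h j) = 1 / 2 * (f (int i) + f (int j) - f (int i - int j))" for i j
    unfolding f_def using h by (intro fbm_cov_grid) simp
  have e_sum: "(\<Sum>i\<le>N. e i) = 0"
    unfolding e_def lessThan_Suc_atMost[symmetric] by (subst sum.lessThan_Suc_shift) simp
  have Y_meas: "Y s \<in> borel_measurable M" for s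
    unfolding Y_def[abs_def]
    by (intro borel_measurable_sum borel_measurable_times borel_measurable_const
        fbm_measurable[OF B] nn)
  have Y_sq: "expectation (\<lambda>\<omega>. Y s \<omega> * Y s \<omega>)
      = - (1 / 2) * (\<Sum>i\<le>N. \<Sum>j\<le>N. e i * e j * f (int i - int j))" for s
  proof -
    have "expectation (\<lambda>\<omega>. Y s \<omega> * Y s \<omega>)
      = (\<Sum>i\<le>N. \<Sum>j\<le>N. e i * e j * (1 / 2 * (f (int (i + s)) + f (int (j + s)) - f (int i - int j))))"
      unfolding Y_def fbm_lincomb_mult(2)[OF B H0 nn nn] cov by simp
    also have "\<dots> = - (1 / 2) * (\<Sum>i\<le>N. \<Sum>j\<le>N. e i * e j * f (int i - int j))"
      by (rule sum_lag_eq[OF e_sum])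
    finally show ?thesis .
  qed
  have cov_0: "fbm_cov H (grid h 0) (grid h i) = 0" "fbm_cov H (grid h i) (grid h 0) = 0" for i
    using f_minus[of "int i"] by (simp_all add: cov f0)
  have "expectation (\<lambda>\<omega>. Y 0 \<omega> * Y 0 \<omega>)
      = (\<Sum>i<Suc N. \<Sum>j<Suc N. e i * e j * fbm_cov H (grid h i) (grid h j))"
    unfolding Y_def fbm_lincomb_mult(2)[OF B H0 nn nn] by (simp add: lessThan_Suc_atMost)
  \<comment> \<open>The terms with index 0 drop out, since time 0 has covariance 0 with every grid
    time; the others carry \<open>e (Suc i)\<close> = \<open>c i\<close>.\<close>
  also have "\<dots> = ?Q"
    unfolding sum.lessThan_Suc_shift by (simp add: cov_0 e_def)
  finally have "expectation (\<lambda>\<omega>. Y 0 \<omega> * Y 0 \<omega>) = ?Q" .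
  moreover have "expectation (\<lambda>\<omega>. Y 0 \<omega> * Y 0 \<omega>) \<ge> 0" by simp
  ultimately have "expectation (\<lambda>\<omega>. Y 0 \<omega> * Y 0 \<omega>) = 0" using \<open>\<not> 0 < ?Q\<close> by linarith
  \<comment> \<open>The formula \<open>Y_sq\<close> does not contain s, so its vanishing at s = 0
    carries over to every s.\<close>
  then have Y_sq_0: "expectation (\<lambda>\<omega>. Y s \<omega> * Y s \<omega>) = 0" for s
    unfolding Y_sq .
  have Y_0: "AE \<omega> in M. Y s \<omega> = 0" for s
  proof -
    have "integrable M (\<lambda>\<omega>. Y s \<omega> * Y s \<omega>)"
      unfolding Y_def by (rule fbm_lincomb_mult(1)[OF B H0 nn nn])
    from integral_nonneg_eq_0_iff_AE[OF this] Y_sq_0[of s] show ?thesis by simp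
  qed
  \<comment> \<open>Because the coefficients \<open>e\<close> sum to 0, the correlation of
    \<open>Y s\<close> with B at grid index a is (u(s) - u(s - a)) / 2.\<close>
  define u where "u k = (\<Sum>i\<le>N. e i * f (k + int i))" for k
  have u_shift: "u (int s) = u (int s - int a)" for s a
  proof -
    have "expectation (\<lambda>\<omega>. Y s \<omega> * (\<Sum>j\<in>{a}. 1 * B (grid h j) \<omega>)) = expectation (\<lambda>\<omega>. 0)"
    proof (rule integral_cong_AE)
      show "AE \<omega> in M. Y s \<omega> * (\<Sum>j\<in>{a}. 1 * B (grid h j) \<omega>) = 0"
        using Y_0[of s] by eventually_elim simp
      show "(\<lambda>\<omega>. Y s \<omega> * (\<Sum>j\<in>{a}. 1 * B (grid h j) \<omega>)) \<in> borel_measurable M"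
        by (intro borel_measurable_times borel_measurable_sum borel_measurable_const Y_meas
            fbm_measurable[OF B nn])
    qed simp
    moreover have "expectation (\<lambda>\<omega>. Y s \<omega> * (\<Sum>j\<in>{a}. 1 * B (grid h j) \<omega>))
        = (\<Sum>i\<le>N. e i * (1 / 2 * (f (int (i + s)) + f (int a) - f (int (i + s) - int a))))"
      unfolding Y_def fbm_lincomb_mult(2)[OF B H0 nn nn] cov by simp
    moreover have "\<dots> = 1 / 2 * (u (int s) + f (int a) * (\<Sum>i\<le>N. e i) - u (int s - int a))"
      by (simp add: u_def sum_distrib_left sum.distrib sum_subtractf algebra_simps)
    ultimately show ?thesis using e_sum by simp
  qed
  \<comment> \<open>Nonnegative k are reached with s = a = k, negative ones with s = 0 and a =
    -k.\<close>
  have u_const: "u k = u 0" for k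
  proof (cases "k \<ge> 0")
    case True
    then show ?thesis using u_shift[of "nat k" "nat k"] by simp
  next
    case False
    then show ?thesis using u_shift[of 0 "nat (- k)"] by simp
  qed
  define p where "p = (\<Sum>i\<le>N. monom (complex_of_real (e i)) i)"
  have coeff_p: "coeff p i = (if i \<le> N then complex_of_real (e i) else 0)" for i
    unfolding p_def coeff_sum by simp
  \<comment> \<open>The index is raised by one because \<open>e\<close> has the extra coefficient
    for time 0 in front.\<close>
  have "coeff p (Suc i0) \<noteq> 0" using c by (simp add: coeff_p e_def)
  then have "p \<noteq> 0" by auto
  have deg_p: "degree p \<le> N" by (rule degree_le) (simp add: coeff_p)
  have "complex_of_real (fgn_cov H h 0) = 0"
  proof (rule linear_recurrence_int_eq_0[OF _ \<open>p \<noteq> 0\<close>])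
    show "((\<lambda>k. complex_of_real (fgn_cov H h k)) \<longlongrightarrow> 0) cofinite"
      using tendsto_of_real[OF fgn_cov_tendsto_0[OF H h]] by simp
    show "shift_apply p (\<lambda>k. complex_of_real (fgn_cov H h k)) k = 0" for k
    proof -
      have "shift_apply p (\<lambda>k. complex_of_real (fgn_cov H h k)) k
          = complex_of_real (\<Sum>i\<le>N. e i * fgn_cov H h (k + int i))"
        unfolding shift_apply_extend[OF deg_p] by (simp add: coeff_p)
      \<comment> \<open>\<open>fgn_cov\<close> is the second difference of the lag function, so its
        recurrence is the second difference of the constant sequence \<open>u\<close>.\<close>
      also have "(\<Sum>i\<le>N. e i * fgn_cov H h (k + int i)) = u (k + 1) - 2 * u k + u (k - 1)"
        by (simp add: u_def fgn_cov_def f_def sum_distrib_left sum.distrib sum_subtractf algebra_simps)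
      also have "\<dots> = 0" using u_const[of "k + 1"] u_const[of k] u_const[of "k - 1"] by simp
      finally show ?thesis by simp
    qed
  qed
  then show False using fgn_cov_0[OF h, of H] by simp
qed

section \<open>Algebra of generalised least squares for a symmetric positive definite matrix\<close>

section \<open>The generalised least squares estimator\<close>

lemma scalar_prod_mult_mat_vec_sum:
  fixes A :: "'a::comm_semiring_0 mat"
  assumes "A \<in> carrier_mat n n" "v \<in> carrier_vec n" "w \<in> carrier_vec n"
  shows "scalar_prod v (A *\<^sub>v w)
    = (\<Sum>i<n. \<Sum>j<n. vec_index v i * vec_index w j * A $$ (i, j))"
  using assms
  by (simp add: scalar_prod_def lessThan_atLeast0[symmetric] sum_distrib_left mult_ac)

lemma euclid_norm_power4: "euclid_norm v ^ 4 = (scalar_prod v v)\<^sup>2"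
proof -
  have "0 \<le> scalar_prod v v" by (simp add: scalar_prod_def sum_nonneg)
  then have "(euclid_norm v)\<^sup>2 = scalar_prod v v" by (simp add: euclid_norm_def)
  moreover have "euclid_norm v ^ 4 = ((euclid_norm v)\<^sup>2)\<^sup>2" by (simp flip: power_mult)
  ultimately show ?thesis by (simp only:)
qed

text \<open>The weights are the inverse of A applied to T. The final inequality is Cauchy-Schwarz
  for the form of A applied to T and w, because \<open>A *\<^sub>v w\<close> = T turns the mixed
  term into the scalar product of T with itself.\<close>

lemma generalized_least_squares_weights:
  fixes A :: "real mat"
  assumes A: "A \<in> carrier_mat n n" and sym: "transpose_mat A = A"
    and pos: "\<And>v. v \<in> carrier_vec n \<Longrightarrow> v \<noteq> 0\<^sub>v n \<Longrightarrow> 0 < scalar_prod v (A *\<^sub>v v)"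
    and T: "T \<in> carrier_vec n" "T \<noteq> 0\<^sub>v n"
  obtains w where "w \<in> carrier_vec n" and "A *\<^sub>v w = T" and "0 < scalar_prod w T"
    and "\<And>z. z \<in> carrier_vec n \<Longrightarrow> scalar_prod T (the (mat_inverse A) *\<^sub>v z) = scalar_prod w z"
    and "(scalar_prod T T)\<^sup>2 \<le> scalar_prod T (A *\<^sub>v T) * scalar_prod w T"
proof -
  have "det A \<noteq> 0"
  proof
    assume "det A = 0"
    then obtain v where v: "v \<in> carrier_vec n" "v \<noteq> 0\<^sub>v n" "A *\<^sub>v v = 0\<^sub>v n"
      using det_0_iff_vec_prod_zero[OF A] by auto
    from pos[OF v(1,2)] v show False by simp
  qed
  \<comment> \<open>Being a unit of the matrix ring excludes the result \<open>None\<close>, so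
    \<open>the (mat_inverse A)\<close> is a genuine inverse.\<close>
  then have "A \<in> Units (ring_mat TYPE(real) n ())" by (rule det_non_zero_imp_unit[OF A])
  then obtain G where "mat_inverse A = Some G"
    using mat_inverse(1)[OF A, where b = "()"] by fastforce
  with mat_inverse(2)[OF A this]
  have G: "the (mat_inverse A) = G" "G * A = 1\<^sub>m n" "G \<in> carrier_mat n n" by auto
  \<comment> \<open>The transpose moves G from z to T in the scalar product, and symmetry of A gives
    \<open>A * transpose_mat G\<close> = 1 without a separate proof that G is symmetric.\<close>
  define w where "w = transpose_mat G *\<^sub>v T"
  have w: "w \<in> carrier_vec n" using G(3) T by (simp add: w_def)
  have "A * transpose_mat G = transpose_mat (G * A)"
    using transpose_mult[OF G(3) A] sym by simp
  also have "\<dots> = 1\<^sub>m n" by (simp add: G(2))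
  finally have "A * transpose_mat G = 1\<^sub>m n" .
  moreover have "A *\<^sub>v w = (A * transpose_mat G) *\<^sub>v T"
    unfolding w_def using A G(3) T by (subst assoc_mult_mat_vec) auto
  ultimately have Aw: "A *\<^sub>v w = T" using T by simp
  have "w \<noteq> 0\<^sub>v n" using Aw A T by auto
  with pos[OF w] have q: "0 < scalar_prod w T" by (simp add: Aw)
  have inv: "scalar_prod T (the (mat_inverse A) *\<^sub>v z) = scalar_prod w z" if "z \<in> carrier_vec n" for z
    unfolding w_def G(1) using that transpose_vec_mult_scalar[OF G(3) that T(1)] by simp
  \<comment> \<open>This s minimises the quadratic form of A at T - s w; nonnegativity of the
    minimum is the desired inequality.\<close>
  let ?s = "scalar_prod T T / scalar_prod w T"
  let ?v = "T + (- ?s) \<cdot>\<^sub>v w"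
  have v: "?v \<in> carrier_vec n" using T w by simp
  have Av: "A *\<^sub>v ?v = A *\<^sub>v T + (- ?s) \<cdot>\<^sub>v T"
    using A T w by (simp add: mult_add_distrib_mat_vec mult_mat_vec Aw)
  have AT: "A *\<^sub>v T \<in> carrier_vec n" using A T by simp
  have wAT: "scalar_prod w (A *\<^sub>v T) = scalar_prod T T"
    using transpose_vec_mult_scalar[OF A T(1) w] sym Aw by simp
  have "0 \<le> scalar_prod ?v (A *\<^sub>v ?v)"
  proof (cases "?v = 0\<^sub>v n")
    case True
    then show ?thesis using A by simp
  next
    case False
    then show ?thesis using pos[OF v] by simp
  qed
  also have "scalar_prod ?v (A *\<^sub>v ?v)
      = scalar_prod T (A *\<^sub>v T) - 2 * ?s * scalar_prod T T + ?s\<^sup>2 * scalar_prod w T"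
    unfolding Av using T w AT
    by (simp add: scalar_prod_add_distrib[of _ n] add_scalar_prod_distrib[of _ n] wAT
        power2_eq_square algebra_simps)
  also have "\<dots> = scalar_prod T (A *\<^sub>v T) - (scalar_prod T T)\<^sup>2 / scalar_prod w T"
    using q by (simp add: power2_eq_square field_simps)
  finally have cs: "(scalar_prod T T)\<^sup>2 \<le> scalar_prod T (A *\<^sub>v T) * scalar_prod w T"
    using q by (simp add: field_simps)
  show thesis by (rule that[OF w Aw q inv cs])
qed

text \<open>Evaluating each path at one time is a measurable coordinate projection, so independence
  of the paths passes to the chosen values; the product formula is then applied to the pair r,
  s.\<close>

lemma (in prob_space) independent_processes_expectation_mult:
  fixes X :: "'i \<Rightarrow> 't \<Rightarrow> 'a \<Rightarrow> real"
  assumes ind: "independent_processes M I T X"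
    and "r \<in> I" "s \<in> I" "r \<noteq> s" and "t \<in> T" "u \<in> T"
    and "integrable M (X r t)" "integrable M (X s u)"
  shows "expectation (\<lambda>\<omega>. X r t \<omega> * X s u \<omega>) = expectation (X r t) * expectation (X s u)"
proof -
  define \<tau> where "\<tau> i = (if i = r then t else u)" for i
  have \<tau>: "\<tau> i \<in> T" for i using assms by (simp add: \<tau>_def)
  have "indep_vars (\<lambda>_. borel) (\<lambda>i \<omega>. (\<lambda>t\<in>T. X i t \<omega>) (\<tau> i)) I"
    using ind unfolding independent_processes_def
    by (rule indep_vars_compose2) (rule measurable_component_singleton[OF \<tau>])
  then have "indep_vars (\<lambda>_. borel) (\<lambda>i. X i (\<tau> i)) I" using \<tau> by simp
  then have "indep_vars (\<lambda>_. borel) (\<lambda>i. X i (\<tau> i)) {r, s}"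
    by (rule indep_vars_subset) (use assms in auto)
  then have "expectation (\<lambda>\<omega>. \<Prod>i\<in>{r, s}. X i (\<tau> i) \<omega>) = (\<Prod>i\<in>{r, s}. expectation (X i (\<tau> i)))"
    by (intro indep_vars_lebesgue_integral) (use assms in \<open>auto simp: \<tau>_def\<close>)
  then show ?thesis using \<open>r \<noteq> s\<close> by (simp add: \<tau>_def)
qed

section \<open>The superposed noise and the estimator expressed through it\<close>

locale mixed_fbm = prob_space M for M :: "'a measure" +
  fixes B :: "nat \<Rightarrow> real \<Rightarrow> 'a \<Rightarrow> real" and H :: "nat \<Rightarrow> real" and m :: nat and h :: real
  assumes h_pos: "h > 0" and m_pos: "m \<ge> 1"
    and H_range: "\<And>r. r \<in> {1..m} \<Longrightarrow> 1 / 2 < H r \<and> H r < 1"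
    and fbm: "\<And>r. r \<in> {1..m} \<Longrightarrow> fractional_brownian_motion M (H r) (B r)"
    and indep: "independent_processes M {1..m} {0..} B"
begin

definition noise :: "nat \<Rightarrow> 'a \<Rightarrow> real" where
  "noise k \<omega> = (\<Sum>r=1..m. B r (grid h k) \<omega>)"

definition noise_cov :: "nat \<Rightarrow> nat \<Rightarrow> real" where
  "noise_cov k l = (\<Sum>r=1..m. fbm_cov (H r) (grid h k) (grid h l))"

lemma H_pos: "r \<in> {1..m} \<Longrightarrow> H r > 0"
  using H_range[of r] by linarith

lemma grid_h_nonneg: "grid h k \<ge> 0"
  using h_pos by (simp add: grid_nonneg)

lemma noise_integrable: "integrable M (noise k)"
  unfolding noise_def[abs_def]
  by (intro Bochner_Integration.integrable_sum fbm_integrable[OF fbm H_pos grid_h_nonneg])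

lemma noise_expectation: "expectation (noise k) = 0"
proof -
  have "expectation (noise k) = (\<Sum>r=1..m. expectation (B r (grid h k)))"
    unfolding noise_def[abs_def]
    by (intro Bochner_Integration.integral_sum fbm_integrable[OF fbm H_pos grid_h_nonneg])
  also have "\<dots> = 0"
    by (intro sum.neutral ballI fbm_mean[OF fbm grid_h_nonneg])
  finally show ?thesis .
qed

text \<open>Distinct processes are independent and centred, so only the diagonal terms r = s
  contribute.\<close>

lemma noise_mult:
  shows "integrable M (\<lambda>\<omega>. noise k \<omega> * noise l \<omega>)"
    and "expectation (\<lambda>\<omega>. noise k \<omega> * noise l \<omega>) = noise_cov k l"
proof -
  have int: "integrable M (\<lambda>\<omega>. B r (grid h k) \<omega> * B s (grid h l) \<omega>)"
    if "r \<in> {1..m}" "s \<in> {1..m}" for r s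
    by (rule fbm_mult_integrable[OF fbm[OF that(1)] H_pos[OF that(1)] grid_h_nonneg
          fbm[OF that(2)] H_pos[OF that(2)] grid_h_nonneg])
  have cross: "expectation (\<lambda>\<omega>. B r (grid h k) \<omega> * B s (grid h l) \<omega>)
      = (if s = r then fbm_cov (H r) (grid h k) (grid h l) else 0)"
    if rs: "r \<in> {1..m}" "s \<in> {1..m}" for r s
  proof (cases "r = s")
    case True
    then show ?thesis using fbm_covariance[OF fbm[OF rs(1)] grid_h_nonneg grid_h_nonneg] by simp
  next
    case False
    have "expectation (B r (grid h k)) = 0"
      by (rule fbm_mean[OF fbm[OF rs(1)] grid_h_nonneg])
    moreover have "expectation (\<lambda>\<omega>. B r (grid h k) \<omega> * B s (grid h l) \<omega>)
        = expectation (B r (grid h k)) * expectation (B s (grid h l))"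
      by (rule independent_processes_expectation_mult[OF indep rs False _ _
            fbm_integrable[OF fbm[OF rs(1)] H_pos[OF rs(1)] grid_h_nonneg]
            fbm_integrable[OF fbm[OF rs(2)] H_pos[OF rs(2)] grid_h_nonneg]])
        (simp_all add: grid_h_nonneg)
    ultimately show ?thesis using False by simp
  qed
  show "integrable M (\<lambda>\<omega>. noise k \<omega> * noise l \<omega>)"
    using expectation_lincomb_mult(1)[where I = "{1..m}" and J = "{1..m}" and X = "\<lambda>r. B r (grid h k)"
        and Y = "\<lambda>r. B r (grid h l)" and a = "\<lambda>_. 1" and b = "\<lambda>_. 1", OF int]
    by (simp add: noise_def)
  have "expectation (\<lambda>\<omega>. noise k \<omega> * noise l \<omega>)
      = (\<Sum>r=1..m. \<Sum>s=1..m. expectation (\<lambda>\<omega>. B r (grid h k) \<omega> * B s (grid h l) \<omega>))"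
    using expectation_lincomb_mult(2)[where I = "{1..m}" and J = "{1..m}" and X = "\<lambda>r. B r (grid h k)"
        and Y = "\<lambda>r. B r (grid h l)" and a = "\<lambda>_. 1" and b = "\<lambda>_. 1", OF int]
    by (simp add: noise_def)
  also have "\<dots> = noise_cov k l"
    unfolding noise_cov_def by (intro sum.cong refl) (simp add: cross)
  finally show "expectation (\<lambda>\<omega>. noise k \<omega> * noise l \<omega>) = noise_cov k l" .
qed

text \<open>The form splits into the forms of the single processes, each positive, and m >= 1 makes
  this sum nonempty.\<close>

lemma noise_cov_pos_def:
  assumes "i0 < N" "c i0 \<noteq> 0"
  shows "0 < (\<Sum>i<N. \<Sum>j<N. c i * c j * noise_cov (i + 1) (j + 1))"
proof -
  have "(\<Sum>i<N. \<Sum>j<N. c i * c j * noise_cov (i + 1) (j + 1))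
    = (\<Sum>i<N. \<Sum>r=1..m. \<Sum>j<N. c i * c j * fbm_cov (H r) (grid h (i + 1)) (grid h (j + 1)))"
    unfolding noise_cov_def sum_distrib_left by (rule sum.cong[OF refl]) (rule sum.swap)
  also have "\<dots> = (\<Sum>r=1..m. \<Sum>i<N. \<Sum>j<N. c i * c j * fbm_cov (H r) (grid h (i + 1)) (grid h (j + 1)))"
    by (rule sum.swap)
  also have "\<dots> > 0"
  proof (rule sum_pos)
    fix r assume r: "r \<in> {1..m}"
    then show "0 < (\<Sum>i<N. \<Sum>j<N. c i * c j * fbm_cov (H r) (grid h (i + 1)) (grid h (j + 1)))"
      using H_range[OF r] by (intro fbm_cov_grid_pos_def[where c = c, OF fbm[OF r] _ _ h_pos assms]) simp_all
  qed (use m_pos in simp_all)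
  finally show ?thesis .
qed

text \<open>This passes from matrices to finite sums. The number q = \<open>scalar_prod w T\<close>
  is both the normaliser and the second moment of the weighted noise, since w is mapped to T by the
  covariance matrix. The weights depend on neither the parameters nor the outcome.\<close>

lemma estimator_decomposition:
  assumes N: "N \<ge> 1"
  obtains w q where "q > 0"
    and "\<And>\<theta> \<alpha> \<omega>. drift_estimator H m h (obs_process \<theta> \<alpha> m B) N \<omega>
          = \<theta> + \<alpha> / q * (\<Sum>i<N. w i * noise (i + 1) \<omega>)"
    and "(\<Sum>i<N. \<Sum>j<N. w i * w j * noise_cov (i + 1) (j + 1)) = q"
    and "euclid_norm (time_vec h N) ^ 4
      \<le> (\<Sum>i<N. \<Sum>j<N. grid h (i + 1) * grid h (j + 1) * noise_cov (i + 1) (j + 1)) * q"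
proof -
  let ?A = "mixed_cov_mat H m h N" and ?T = "time_vec h N"
  have A: "?A \<in> carrier_mat N N" by (simp add: mixed_cov_mat_def)
  have A_index: "?A $$ (i, j) = noise_cov (i + 1) (j + 1)" if "i < N" "j < N" for i j
    using that by (simp add: mixed_cov_mat_def fbm_cov_mat_def noise_cov_def)
  have T: "?T \<in> carrier_vec N" by (simp add: time_vec_def)
  have T_index: "vec_index ?T i = grid h (i + 1)" if "i < N" for i
    using that by (simp add: time_vec_def)
  have quad: "scalar_prod v (?A *\<^sub>v v)
      = (\<Sum>i<N. \<Sum>j<N. vec_index v i * vec_index v j * noise_cov (i + 1) (j + 1))"
    if "v \<in> carrier_vec N" for v
    unfolding scalar_prod_mult_mat_vec_sum[OF A that that]
    by (intro sum.cong refl) (simp add: A_index)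
  have sym: "transpose_mat ?A = ?A"
    by (intro eq_matI) (auto simp: mixed_cov_mat_def fbm_cov_mat_def fbm_cov_def abs_minus_commute add.commute)
  have pos: "0 < scalar_prod v (?A *\<^sub>v v)" if v: "v \<in> carrier_vec N" "v \<noteq> 0\<^sub>v N" for v
  proof -
    obtain i where "i < N" "vec_index v i \<noteq> 0" using v by (auto simp: Matrix.vec_eq_iff)
    then show ?thesis unfolding quad[OF v(1)] by (rule noise_cov_pos_def)
  qed
  have T_nz: "?T \<noteq> 0\<^sub>v N"
  proof
    assume "?T = 0\<^sub>v N"
    then have "vec_index ?T 0 = 0" using N by simp
    then show False using N h_pos by (simp add: T_index grid_def)
  qed
  from generalized_least_squares_weights[OF A sym pos T T_nz]
  obtain w where w: "w \<in> carrier_vec N" "?A *\<^sub>v w = ?T" and q: "0 < scalar_prod w ?T"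
    and inv: "\<And>z. z \<in> carrier_vec N \<Longrightarrow> scalar_prod ?T (the (mat_inverse ?A) *\<^sub>v z) = scalar_prod w z"
    and cs: "(scalar_prod ?T ?T)\<^sup>2 \<le> scalar_prod ?T (?A *\<^sub>v ?T) * scalar_prod w ?T"
    by metis
  have wT: "scalar_prod w ?T = (\<Sum>i<N. vec_index w i * grid h (i + 1))"
    by (simp add: scalar_prod_def time_vec_def lessThan_atLeast0)
  show thesis
  proof (rule that[OF q])
    fix \<theta> \<alpha> \<omega>
    let ?z = "obs_vec (obs_process \<theta> \<alpha> m B) h N \<omega>"
    have "scalar_prod w ?z = (\<Sum>i<N. vec_index w i * (\<theta> * grid h (i + 1) + \<alpha> * noise (i + 1) \<omega>))"
      by (simp add: scalar_prod_def obs_vec_def obs_process_def noise_def lessThan_atLeast0)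
    also have "\<dots> = \<theta> * scalar_prod w ?T + \<alpha> * (\<Sum>i<N. vec_index w i * noise (i + 1) \<omega>)"
      unfolding wT by (simp add: sum_distrib_left sum.distrib algebra_simps)
    finally have wz: "scalar_prod w ?z
        = \<theta> * scalar_prod w ?T + \<alpha> * (\<Sum>i<N. vec_index w i * noise (i + 1) \<omega>)" .
    have "?z \<in> carrier_vec N" by (simp add: obs_vec_def)
    \<comment> \<open>The fact \<open>inv\<close> is used twice: at the observations for the
      numerator and at T for the denominator.\<close>
    then have "drift_estimator H m h (obs_process \<theta> \<alpha> m B) N \<omega> = scalar_prod w ?z / scalar_prod w ?T"
      by (simp add: drift_estimator_def inv T)
    then show "drift_estimator H m h (obs_process \<theta> \<alpha> m B) N \<omega>
        = \<theta> + \<alpha> / scalar_prod w ?T * (\<Sum>i<N. vec_index w i * noise (i + 1) \<omega>)"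
      unfolding wz using q by (simp add: field_simps)
  next
    show "(\<Sum>i<N. \<Sum>j<N. vec_index w i * vec_index w j * noise_cov (i + 1) (j + 1)) = scalar_prod w ?T"
      using quad[OF w(1)] w(2) by simp
  next
    have "scalar_prod ?T (?A *\<^sub>v ?T)
        = (\<Sum>i<N. \<Sum>j<N. grid h (i + 1) * grid h (j + 1) * noise_cov (i + 1) (j + 1))"
      unfolding quad[OF T] by (intro sum.cong refl) (simp add: T_index)
    then show "euclid_norm ?T ^ 4
        \<le> (\<Sum>i<N. \<Sum>j<N. grid h (i + 1) * grid h (j + 1) * noise_cov (i + 1) (j + 1)) * scalar_prod w ?T"
      using cs by (simp add: euclid_norm_power4)
  qed
qed

end

section \<open>Explicit bounds in terms of N h and their limits\<close>

section \<open>Variance bounds\<close>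

text \<open>Without the nonpositive term -|t - s|^(2H) the weighted kernel is half the sum of two
  products of one-variable functions. Both have the same double sum, so the halves add up to one
  product.\<close>

lemma fbm_cov_weighted_sum_le:
  assumes "\<And>i. i \<in> I \<Longrightarrow> t i \<ge> 0"
  shows "(\<Sum>i\<in>I. \<Sum>j\<in>I. t i * t j * fbm_cov H (t i) (t j))
    \<le> (\<Sum>j\<in>I. t j) * (\<Sum>i\<in>I. t i powr (2 * H + 1))"
proof -
  have "t i * t j * fbm_cov H (t i) (t j)
      \<le> 1 / 2 * (t i powr (2 * H + 1) * t j) + 1 / 2 * (t i * t j powr (2 * H + 1))"
    if "i \<in> I" "j \<in> I" for i j
  proof -
    have ij: "0 \<le> t i" "0 \<le> t j" using assms that by auto
    have "t i * t j * fbm_cov H (t i) (t j)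
        \<le> t i * t j * (1 / 2 * (t i powr (2 * H) + t j powr (2 * H)))"
      using ij by (intro mult_left_mono) (simp_all add: fbm_cov_def)
    also have "\<dots> = 1 / 2 * ((t i * t i powr (2 * H)) * t j) + 1 / 2 * (t i * (t j * t j powr (2 * H)))"
      by (simp add: field_simps)
    also have "\<dots> = 1 / 2 * (t i powr (2 * H + 1) * t j) + 1 / 2 * (t i * t j powr (2 * H + 1))"
      using ij by (simp only: powr_mult_base add.commute)
    finally show ?thesis .
  qed
  then have "(\<Sum>i\<in>I. \<Sum>j\<in>I. t i * t j * fbm_cov H (t i) (t j))
      \<le> (\<Sum>i\<in>I. \<Sum>j\<in>I. 1 / 2 * (t i powr (2 * H + 1) * t j) + 1 / 2 * (t i * t j powr (2 * H + 1)))"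
    by (intro sum_mono)
  also have "\<dots> = 1 / 2 * ((\<Sum>i\<in>I. t i powr (2 * H + 1)) * (\<Sum>j\<in>I. t j))
      + 1 / 2 * ((\<Sum>i\<in>I. t i) * (\<Sum>j\<in>I. t j powr (2 * H + 1)))"
    by (simp only: sum.distrib sum_product sum_distrib_left[symmetric])
  also have "\<dots> = (\<Sum>j\<in>I. t j) * (\<Sum>i\<in>I. t i powr (2 * H + 1))" by simp
  finally show ?thesis .
qed

lemma sum_grid: "(\<Sum>j=1..N. grid h j) = h * (real N * (real N + 1) / 2)"
  by (induction N) (simp_all add: grid_def field_simps)

lemma euclid_norm_time_vec_power4:
  "euclid_norm (time_vec h N) ^ 4 = (h\<^sup>2 * (real N * (real N + 1) * (2 * real N + 1) / 6))\<^sup>2"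
proof -
  have "scalar_prod (time_vec h N) (time_vec h N) = (\<Sum>i<N. (grid h (Suc i))\<^sup>2)"
    by (simp add: scalar_prod_def time_vec_def lessThan_atLeast0 power2_eq_square)
  also have "\<dots> = h\<^sup>2 * (real N * (real N + 1) * (2 * real N + 1) / 6)"
    by (induction N) (simp_all add: grid_def field_simps power2_eq_square)
  finally have T: "scalar_prod (time_vec h N) (time_vec h N)
      = h\<^sup>2 * (real N * (real N + 1) * (2 * real N + 1) / 6)" .
  show ?thesis unfolding euclid_norm_power4 T ..
qed

lemma ols_variance_bound:
  assumes h: "h > 0" and N: "N \<ge> 1" and H: "2 * H + 1 \<ge> 0"
  shows "(\<Sum>j=1..N. grid h j) * (\<Sum>i=1..N. grid h i powr (2 * H + 1))
    \<le> 9 / 2 * (real N * h) powr (2 * H - 2) * euclid_norm (time_vec h N) ^ 4"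
proof -
  define n where "n = real N"
  have n: "n \<ge> 1" using N by (simp add: n_def)
  let ?P = "(n * h) powr (2 * H - 2)"
  \<comment> \<open>Every power is replaced by the one at the last time n h; the excess (n h)^3 is
    split off to match the powers of h and n in the fourth power of the norm.\<close>
  have "(\<Sum>i=1..N. grid h i powr (2 * H + 1)) \<le> (\<Sum>i=1..N. (n * h) powr (2 * H + 1))"
    using h H by (intro sum_mono powr_mono2) (auto simp: grid_def n_def)
  also have "\<dots> = n * ((n * h) ^ 3 * ?P)"
  proof -
    have "0 < n * h" using n h by simp
    then have "(n * h) powr 3 = (n * h) ^ 3" using powr_realpow[of "n * h" 3] by simp
    moreover have "(n * h) powr (2 * H + 1) = (n * h) powr 3 * ?P"
      unfolding powr_add[symmetric] by (rule arg_cong[where f = "(powr) (n * h)"]) simp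
    ultimately show ?thesis by (simp add: n_def)
  qed
  finally have "(\<Sum>j=1..N. grid h j) * (\<Sum>i=1..N. grid h i powr (2 * H + 1))
      \<le> h * (n * (n + 1) / 2) * (n * ((n * h) ^ 3 * ?P))"
    unfolding sum_grid n_def[symmetric] using n h by (intro mult_left_mono) auto
  \<comment> \<open>A factor common to both sides is isolated. As the fourth power of the norm has
    denominator 36, the constant 9/2 amounts to the 1/8 here, and the claim reduces to 4 n^3 <= (n +
    1)(2 n + 1)^2.\<close>
  also have "\<dots> = (h ^ 4 * ?P * n\<^sup>2 * (n + 1) / 8) * (4 * n ^ 3)"
    by (simp add: power2_eq_square power3_eq_cube power4_eq_xxxx)
  also have "\<dots> \<le> (h ^ 4 * ?P * n\<^sup>2 * (n + 1) / 8) * ((n + 1) * (2 * n + 1)\<^sup>2)"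
  proof (rule mult_left_mono)
    have "(n + 1) * (2 * n + 1)\<^sup>2 = 4 * n ^ 3 + (8 * n\<^sup>2 + 5 * n + 1)"
      by (simp add: power2_eq_square power3_eq_cube algebra_simps)
    then show "4 * n ^ 3 \<le> (n + 1) * (2 * n + 1)\<^sup>2" using n by simp
  qed (use n h in simp)
  also have "\<dots> = 9 / 2 * ?P * euclid_norm (time_vec h N) ^ 4"
    unfolding euclid_norm_time_vec_power4 n_def[symmetric]
    by (simp add: power2_eq_square power4_eq_xxxx)
  finally show ?thesis unfolding n_def .
qed

context mixed_fbm
begin

lemma noise_cov_weighted_sum_le:
  "(\<Sum>i<N. \<Sum>j<N. grid h (i + 1) * grid h (j + 1) * noise_cov (i + 1) (j + 1))
    \<le> (\<Sum>j=1..N. grid h j) * (\<Sum>r=1..m. \<Sum>i=1..N. grid h i powr (2 * H r + 1))"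
proof -
  have "(\<Sum>i<N. \<Sum>j<N. grid h (i + 1) * grid h (j + 1) * noise_cov (i + 1) (j + 1))
    = (\<Sum>i<N. \<Sum>r=1..m. \<Sum>j<N. grid h (i + 1) * grid h (j + 1) * fbm_cov (H r) (grid h (i + 1)) (grid h (j + 1)))"
    unfolding noise_cov_def sum_distrib_left by (rule sum.cong[OF refl]) (rule sum.swap)
  also have "\<dots> = (\<Sum>r=1..m. \<Sum>i<N. \<Sum>j<N. grid h (i + 1) * grid h (j + 1) * fbm_cov (H r) (grid h (i + 1)) (grid h (j + 1)))"
    by (rule sum.swap)
  also have "\<dots> \<le> (\<Sum>r=1..m. (\<Sum>j<N. grid h (j + 1)) * (\<Sum>i<N. grid h (i + 1) powr (2 * H r + 1)))"
    by (intro sum_mono fbm_cov_weighted_sum_le grid_h_nonneg)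
  also have "\<dots> = (\<Sum>j=1..N. grid h j) * (\<Sum>r=1..m. \<Sum>i=1..N. grid h i powr (2 * H r + 1))"
    by (simp add: sum_distrib_left sum.atLeast1_atMost_eq)
  finally show ?thesis .
qed

lemma estimator_moments:
  fixes \<theta> \<alpha> :: real
  assumes N: "N \<ge> 1"
  defines "X \<equiv> drift_estimator H m h (obs_process \<theta> \<alpha> m B) N"
  shows "integrable M X" and "expectation X = \<theta>"
    and "integrable M (\<lambda>\<omega>. (X \<omega> - \<theta>)\<^sup>2)"
    and "variance X \<le> \<alpha>\<^sup>2 / euclid_norm (time_vec h N) ^ 4 * (\<Sum>j=1..N. grid h j)
      * (\<Sum>r=1..m. \<Sum>i=1..N. grid h i powr (2 * H r + 1))"
proof -
  let ?T4 = "euclid_norm (time_vec h N) ^ 4"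
  obtain w q where q: "q > 0"
    and X: "\<And>\<theta> \<alpha> \<omega>. drift_estimator H m h (obs_process \<theta> \<alpha> m B) N \<omega>
          = \<theta> + \<alpha> / q * (\<Sum>i<N. w i * noise (i + 1) \<omega>)"
    and w: "(\<Sum>i<N. \<Sum>j<N. w i * w j * noise_cov (i + 1) (j + 1)) = q"
    and T4: "?T4 \<le> (\<Sum>i<N. \<Sum>j<N. grid h (i + 1) * grid h (j + 1) * noise_cov (i + 1) (j + 1)) * q"
    by (rule estimator_decomposition[OF N]) (rule that)
  define S where "S \<omega> = (\<Sum>i<N. w i * noise (i + 1) \<omega>)" for \<omega>
  have X_S: "X = (\<lambda>\<omega>. \<theta> + \<alpha> / q * S \<omega>)"
    by (rule ext) (simp add: X_def X S_def)
  have S: "integrable M S" "expectation S = 0"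
    unfolding S_def[abs_def] using noise_integrable noise_expectation
    by (simp_all add: Bochner_Integration.integral_sum)
  show int_X: "integrable M X" unfolding X_S using S(1) by simp
  show mean: "expectation X = \<theta>" unfolding X_S using S by (simp add: prob_space)
  have SS: "integrable M (\<lambda>\<omega>. S \<omega> * S \<omega>)" "expectation (\<lambda>\<omega>. S \<omega> * S \<omega>) = q"
    unfolding S_def using expectation_lincomb_mult[OF noise_mult(1),
        where a = w and b = w and I = "{..<N}" and J = "{..<N}", of "\<lambda>i. i + 1" "\<lambda>i. i + 1"]
    by (simp_all add: noise_mult(2) w[simplified])
  have sq: "(X \<omega> - \<theta>)\<^sup>2 = (\<alpha> / q)\<^sup>2 * (S \<omega> * S \<omega>)" for \<omega>
    by (simp add: X_S power2_eq_square)
  show "integrable M (\<lambda>\<omega>. (X \<omega> - \<theta>)\<^sup>2)" unfolding sq using SS(1) by simp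
  \<comment> \<open>The second moment q of \<open>S\<close> is multiplied by (\<alpha> / q)^2,
    leaving one factor q in the denominator; a lower bound on q is therefore what remains.\<close>
  have "variance X = \<alpha>\<^sup>2 * (1 / q)"
    unfolding mean sq using SS(2) q by (simp add: power2_eq_square)
  also have "\<dots> \<le> \<alpha>\<^sup>2 * (((\<Sum>j=1..N. grid h j)
      * (\<Sum>r=1..m. \<Sum>i=1..N. grid h i powr (2 * H r + 1))) / ?T4)"
  proof (rule mult_left_mono)
    have "?T4 > 0"
      unfolding euclid_norm_time_vec_power4 using N h_pos by simp
    moreover have "?T4 \<le> ((\<Sum>j=1..N. grid h j)
      * (\<Sum>r=1..m. \<Sum>i=1..N. grid h i powr (2 * H r + 1))) * q"
      using q by (intro order_trans[OF T4] mult_right_mono noise_cov_weighted_sum_le) simp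
    ultimately show "1 / q \<le> ((\<Sum>j=1..N. grid h j)
      * (\<Sum>r=1..m. \<Sum>i=1..N. grid h i powr (2 * H r + 1))) / ?T4"
      using q by (simp only: pos_le_divide_eq times_divide_eq_left mult_1 pos_divide_le_eq)
  qed simp
  finally show "variance X \<le> \<alpha>\<^sup>2 / ?T4 * (\<Sum>j=1..N. grid h j)
      * (\<Sum>r=1..m. \<Sum>i=1..N. grid h i powr (2 * H r + 1))"
    by simp
qed

lemma estimator_variance_le:
  assumes N: "N \<ge> 1"
  shows "variance (drift_estimator H m h (obs_process \<theta> \<alpha> m B) N)
    \<le> 9 / 2 * \<alpha>\<^sup>2 * (\<Sum>r=1..m. (real N * h) powr (2 * H r - 2))"
proof -
  let ?T4 = "euclid_norm (time_vec h N) ^ 4" and ?t = "\<Sum>j=1..N. grid h j"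
  have T4: "?T4 > 0" unfolding euclid_norm_time_vec_power4 using N h_pos by simp
  have "?t * (\<Sum>r=1..m. \<Sum>i=1..N. grid h i powr (2 * H r + 1))
      = (\<Sum>r=1..m. ?t * (\<Sum>i=1..N. grid h i powr (2 * H r + 1)))"
    by (rule sum_distrib_left)
  also have "\<dots> \<le> (\<Sum>r=1..m. 9 / 2 * (real N * h) powr (2 * H r - 2) * ?T4)"
  proof (rule sum_mono)
    fix r assume "r \<in> {1..m}"
    from H_pos[OF this]
    show "?t * (\<Sum>i=1..N. grid h i powr (2 * H r + 1)) \<le> 9 / 2 * (real N * h) powr (2 * H r - 2) * ?T4"
      by (intro ols_variance_bound h_pos N) simp
  qed
  finally have "?t * (\<Sum>r=1..m. \<Sum>i=1..N. grid h i powr (2 * H r + 1))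
      \<le> 9 / 2 * (\<Sum>r=1..m. (real N * h) powr (2 * H r - 2)) * ?T4"
    by (simp only: sum_distrib_left[symmetric] sum_distrib_right[symmetric])
  then have "\<alpha>\<^sup>2 * (?t * (\<Sum>r=1..m. \<Sum>i=1..N. grid h i powr (2 * H r + 1)))
      \<le> \<alpha>\<^sup>2 * (9 / 2 * (\<Sum>r=1..m. (real N * h) powr (2 * H r - 2)) * ?T4)"
    by (rule mult_left_mono) simp
  then have "\<alpha>\<^sup>2 / ?T4 * ?t * (\<Sum>r=1..m. \<Sum>i=1..N. grid h i powr (2 * H r + 1))
      \<le> 9 / 2 * \<alpha>\<^sup>2 * (\<Sum>r=1..m. (real N * h) powr (2 * H r - 2))"
    using T4 by (simp add: pos_divide_le_eq mult_ac)
  with estimator_moments(4)[OF N] show ?thesis by (rule order_trans)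
qed

text \<open>Each exponent 2 H r - 2 is negative while N h grows without bound, so the finite sum of
  powers squeezes the variance to 0.\<close>

lemma estimator_variance_tendsto_0:
  "(\<lambda>N. variance (drift_estimator H m h (obs_process \<theta> \<alpha> m B) N)) \<longlonglongrightarrow> 0"
proof (rule tendsto_sandwich)
  show "\<forall>\<^sub>F N in sequentially. 0 \<le> variance (drift_estimator H m h (obs_process \<theta> \<alpha> m B) N)"
    by simp
  show "\<forall>\<^sub>F N in sequentially. variance (drift_estimator H m h (obs_process \<theta> \<alpha> m B) N)
      \<le> 9 / 2 * \<alpha>\<^sup>2 * (\<Sum>r=1..m. (real N * h) powr (2 * H r - 2))"
    using eventually_ge_at_top[of 1] by eventually_elim (rule estimator_variance_le)
  have "filterlim (\<lambda>N. real N * h) at_top sequentially"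
    using h_pos filterlim_real_sequentially
    by (intro filterlim_at_top_mult_tendsto_pos[where c = h]) (simp_all add: mult.commute)
  then have "(\<lambda>N. (real N * h) powr (2 * H r - 2)) \<longlonglongrightarrow> 0" if "r \<in> {1..m}" for r
    using H_range[OF that] by (intro tendsto_neg_powr) simp_all
  then show "(\<lambda>N. 9 / 2 * \<alpha>\<^sup>2 * (\<Sum>r=1..m. (real N * h) powr (2 * H r - 2))) \<longlonglongrightarrow> 0"
    by (intro tendsto_mult_right_zero tendsto_null_sum)
qed simp

text \<open>A base of at least 1 makes the power increasing in its exponent, so every term is at
  most the one with the largest Hurst parameter.\<close>

lemma estimator_variance_le_Max:
  assumes N: "N \<ge> 1" and Nh: "real N * h \<ge> 1"
  shows "variance (drift_estimator H m h (obs_process \<theta> \<alpha> m B) N)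
    \<le> 9 / 2 * real m * \<alpha>\<^sup>2 * (real N * h) powr (2 * Max (H ` {1..m}) - 2)"
proof -
  have "(\<Sum>r=1..m. (real N * h) powr (2 * H r - 2))
      \<le> (\<Sum>r=1..m. (real N * h) powr (2 * Max (H ` {1..m}) - 2))"
    using Nh by (intro sum_mono powr_mono) auto
  also have "\<dots> = real m * (real N * h) powr (2 * Max (H ` {1..m}) - 2)" by simp
  finally have "9 / 2 * \<alpha>\<^sup>2 * (\<Sum>r=1..m. (real N * h) powr (2 * H r - 2))
      \<le> 9 / 2 * \<alpha>\<^sup>2 * (real m * (real N * h) powr (2 * Max (H ` {1..m}) - 2))"
    by (rule mult_left_mono) simp
  with estimator_variance_le[OF N]
  have "variance (drift_estimator H m h (obs_process \<theta> \<alpha> m B) N)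
    \<le> 9 / 2 * \<alpha>\<^sup>2 * (real m * (real N * h) powr (2 * Max (H ` {1..m}) - 2))"
    by (rule order_trans)
  then show ?thesis by (simp add: mult_ac)
qed

end

theorem proposition4p3:
  fixes M :: "'a measure"
    and B :: "nat \<Rightarrow> real \<Rightarrow> 'a \<Rightarrow> real"
    and H :: "nat \<Rightarrow> real"
    and m :: nat
    and h \<theta> \<alpha> :: real
  defines "Z \<equiv> obs_process \<theta> \<alpha> m B"
  defines "\<theta>hat \<equiv> drift_estimator H m h Z"
  assumes "prob_space M"
    and "h > 0" and "m \<ge> 1" and "\<alpha> > 0"
    and "\<And>r. r \<in> {1..m} \<Longrightarrow> 1 / 2 < H r \<and> H r < 1"
    and "\<And>r. r \<in> {1..m} \<Longrightarrow> fractional_brownian_motion M (H r) (B r)"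
    and "independent_processes M {1..m} {0..} B"
  shows
    "(\<forall>N\<ge>1.
        prob_space.variance M (\<theta>hat N)
          \<le> \<alpha>\<^sup>2 / euclid_norm (time_vec h N) ^ 4 * (\<Sum>j=1..N. grid h j)
              * (\<Sum>r=1..m. \<Sum>i=1..N. grid h i powr (2 * H r + 1)))
     \<and> (\<forall>N\<ge>1.
        prob_space.variance M (\<theta>hat N)
          \<le> 9 / 2 * \<alpha>\<^sup>2 * (\<Sum>r=1..m. (real N * h) powr (2 * H r - 2))
        \<and> 9 / 2 * \<alpha>\<^sup>2 * (\<Sum>r=1..m. (real N * h) powr (2 * H r - 2))
          = 9 / 2 * \<alpha>\<^sup>2 * (\<Sum>r=1..m. grid h N powr (2 * H r - 2)))
     \<and> (\<forall>N\<ge>1. real N * h \<ge> 1 \<longrightarrow>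
        prob_space.variance M (\<theta>hat N)
          \<le> 9 / 2 * real m * \<alpha>\<^sup>2 * (real N * h) powr (2 * Max (H ` {1..m}) - 2))
     \<and> (\<forall>N\<ge>1. unbiased M (\<theta>hat N) \<theta>)
     \<and> (\<lambda>N. prob_space.variance M (\<theta>hat N)) \<longlonglongrightarrow> 0
     \<and> tendsto_mean_square M \<theta>hat \<theta>"
proof -
  interpret mixed_fbm M B H m h
    using assms(3-) by (intro mixed_fbm.intro mixed_fbm_axioms.intro) auto
  have mean: "expectation (\<theta>hat N) = \<theta>" if "N \<ge> 1" for N
    unfolding \<theta>hat_def Z_def by (rule estimator_moments(2)[OF that])
  have "tendsto_mean_square M \<theta>hat \<theta>"
    unfolding tendsto_mean_square_def
  proof
    show "\<forall>\<^sub>F N in sequentially.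
        \<theta>hat N \<in> borel_measurable M \<and> integrable M (\<lambda>\<omega>. (\<theta>hat N \<omega> - \<theta>)\<^sup>2)"
      using eventually_ge_at_top[of 1] unfolding \<theta>hat_def Z_def
      by eventually_elim
        (intro conjI borel_measurable_integrable estimator_moments(1) estimator_moments(3))
    \<comment> \<open>Variance and mean square error agree by unbiasedness, which is available for N
      >= 1; for the limit it suffices that they agree eventually.\<close>
    have ev: "\<forall>\<^sub>F N in sequentially. variance (\<theta>hat N) = expectation (\<lambda>\<omega>. (\<theta>hat N \<omega> - \<theta>)\<^sup>2)"
      using eventually_ge_at_top[of 1] by eventually_elim (simp add: mean)
    have "(\<lambda>N. variance (\<theta>hat N)) \<longlonglongrightarrow> 0"
      unfolding \<theta>hat_def Z_def by (rule estimator_variance_tendsto_0)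
    from Lim_transform_eventually[OF this ev]
    show "(\<lambda>N. expectation (\<lambda>\<omega>. (\<theta>hat N \<omega> - \<theta>)\<^sup>2)) \<longlonglongrightarrow> 0" .
  qed
  moreover have "grid h N = real N * h" for N by (simp add: grid_def)
  moreover have "unbiased M (\<theta>hat N) \<theta>" if "N \<ge> 1" for N
    unfolding unbiased_def using mean[OF that] estimator_moments(1)[OF that]
    by (simp add: \<theta>hat_def Z_def)
  ultimately show ?thesis
    using estimator_moments(4)[of _ \<theta> \<alpha>, folded Z_def \<theta>hat_def]
      estimator_variance_le[of _ \<theta> \<alpha>, folded Z_def \<theta>hat_def]
      estimator_variance_le_Max[of _ \<theta> \<alpha>, folded Z_def \<theta>hat_def]
      estimator_variance_tendsto_0[of \<theta> \<alpha>, folded Z_def \<theta>hat_def]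
    by simp
qed

end
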